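(* Let $a,b>0$, $c=\sqrt{a^2+b^2}$, $t_0\in\mathbb{R}$, and $$f(t)=\frac{b(c\cosh t+a)}{\sqrt{c^2\cosh^2 t-a^2}},\qquad g(t)=\int_{t_0}^t\sqrt{c^2\cosh^2 z-a^2}\,dz-\frac{c\sinh t\,(c\cosh t+a)}{\sqrt{c^2\cosh^2 t-a^2}}.$$ Consider the nodoid $\mathbf{z}_2(t,v)=(f(t)\cos v,\,f(t)\sin v,\,g(t))$. With $h_2(t)=\dfrac{-ab}{\sqrt{c^2\cosh^2 t-a^2}\,(c\cosh t-a)}$ one has $$(\mathbf{z}_2)_t=\big(c\sinh t\,h_2(t)\cos v,\;c\sinh t\,h_2(t)\sin v,\;b\,h_2(t)\big),\qquad (\mathbf{z}_2)_v=(-f(t)\sin v,\,f(t)\cos v,\,0),$$ and the unit normal is $$\mathbf{n}_2(t,v)=\frac{1}{\sqrt{c^2\cosh^2 t-a^2}}\,(b\cos v,\,b\sin v,\,-c\sinh t).$$ The non-vanishing coefficients of the fundamental forms are $$E=\frac{a^2b^2}{(c\cosh t-a)^2},\quad G=\frac{b^2(c\cosh t+a)}{c\cosh t-a},\quad L=\frac{-ab^2c\cosh t}{(c^2\cosh^2 t-a^2)(c\cosh t-a)},\quad N=\frac{-b^2}{c\cosh t-a},$$ and the principal, mean and Gaussian curvatures are $$k_1=\frac{-c\cosh t}{a(c\cosh t+a)},\quad k_2=\frac{-1}{c\cosh t+a},\quad H=\frac{-1}{2a},\quad K=\frac{c\cosh t}{a(c\cosh t+a)^2}.$$ In particular the mean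 curvature is constant, equal to minus the inverse of the distance $2a$ between the vertices of the hyperbola $x^2/a^2-y^2/b^2=1$. The geodesic curvature of the parallel at parameter $t$ is $k_g(t)=\dfrac{-c\sinh t}{b(c\cosh t+a)}$. For $t_1<t_2$ and $v_1<v_2$, the total curvature over $[t_1,t_2]\times[v_1,v_2]$ is $$\int_{\mathbf{z}_2}K\,d\sigma=c(v_2-v_1)\left.\frac{\sinh t}{\sqrt{c^2\cosh^2 t-a^2}}\right|_{t=t_1}^{t=t_2}.$$
   Context: For a surface of revolution $\mathbf{x}(t,v)=(f(t)\cos v,f(t)\sin v,g(t))$ with $f>0$, the unit normal is $\mathbf{n}=\frac{\mathbf{x}_t\times\mathbf{x}_v}{|\mathbf{x}_t\times\mathbf{x}_v|}$, and $E=\langle\mathbf{x}_t,\mathbf{x}_t\rangle$, $F=\langle\mathbf{x}_t,\mathbf{x}_v\rangle$, $G=\langle\mathbf{x}_v,\mathbf{x}_v\rangle$, $L=\langle\mathbf{x}_{tt},\mathbf{n}\rangle$, $M=\langle\mathbf{x}_{tv},\mathbf{n}\rangle$, $N=\langle\mathbf{x}_{vv},\mathbf{n}\rangle$. The principal curvatures are $k_1=L/E$, $k_2=N/G$, the mean curvature is $H=(k_1+k_2)/2$, and the Gaussian curvature is $K=LN/(EG)$. The geodesic curvature of an arc-length parametrized curve $\alpha$ in the surface is $k_g=\langle\alpha'',\mathbf{u}\rangle$, where $\mathbf{u}$ is the unit tangent vector to the surface with $\alpha'\times\mathbf{u}=\mathbf{n}$; the parallel at parameter $t$ is the curve $v\mapsto\mathbf{x}(t,v)$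 traversed with $v$ increasing. The area element is $d\sigma=|\mathbf{x}_t|\,|\mathbf{x}_v|\,dt\,dv$. *)

theory Defs
  imports "HOL-Analysis.Analysis"
begin

text \<open>
  A parametrized surface is a map \<open>X t v\<close> into \<open>real ^ 3\<close>. Since \<open>vector_derivative\<close> is total, the existence of the
  derivatives used below is recorded separately in \<open>twice_partially_differentiable\<close>.
\<close>

definition surface_of_revolution ::
    "(real \<Rightarrow> real) \<Rightarrow> (real \<Rightarrow> real) \<Rightarrow> real \<Rightarrow> real \<Rightarrow> real ^ 3" where
  "surface_of_revolution f g = (\<lambda>t v. vector [f t * cos v, f t * sin v, g t])"

definition partial_t :: "(real \<Rightarrow> real \<Rightarrow> real ^ 3) \<Rightarrow> real \<Rightarrow> real \<Rightarrow> real ^ 3" where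
  "partial_t X t v = vector_derivative (\<lambda>s. X s v) (at t)"

definition partial_v :: "(real \<Rightarrow> real \<Rightarrow> real ^ 3) \<Rightarrow> real \<Rightarrow> real \<Rightarrow> real ^ 3" where
  "partial_v X t v = vector_derivative (\<lambda>w. X t w) (at v)"

definition twice_partially_differentiable :: "(real \<Rightarrow> real \<Rightarrow> real ^ 3) \<Rightarrow> bool" where
  "twice_partially_differentiable X \<longleftrightarrow>
     (\<forall>t v. (\<lambda>s. X s v) differentiable (at t) \<and>
            (\<lambda>w. X t w) differentiable (at v) \<and>
            (\<lambda>s. partial_t X s v) differentiable (at t) \<and>
            (\<lambda>w. partial_t X t w) differentiable (at v) \<and>
            (\<lambda>s. partial_v X s v) differentiable (at t) \<and>
            (\<lambda>w. partial_v X t w) differentiable (at v))"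

definition unit_normal :: "(real \<Rightarrow> real \<Rightarrow> real ^ 3) \<Rightarrow> real \<Rightarrow> real \<Rightarrow> real ^ 3" where
  "unit_normal X t v =
     (1 / norm (cross3 (partial_t X t v) (partial_v X t v))) *\<^sub>R
       cross3 (partial_t X t v) (partial_v X t v)"

definition coeff_E :: "(real \<Rightarrow> real \<Rightarrow> real ^ 3) \<Rightarrow> real \<Rightarrow> real \<Rightarrow> real" where
  "coeff_E X t v = partial_t X t v \<bullet> partial_t X t v"

definition coeff_F :: "(real \<Rightarrow> real \<Rightarrow> real ^ 3) \<Rightarrow> real \<Rightarrow> real \<Rightarrow> real" where
  "coeff_F X t v = partial_t X t v \<bullet> partial_v X t v"

definition coeff_G :: "(real \<Rightarrow> real \<Rightarrow> real ^ 3) \<Rightarrow> real \<Rightarrow> real \<Rightarrow> real" where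
  "coeff_G X t v = partial_v X t v \<bullet> partial_v X t v"

definition coeff_L :: "(real \<Rightarrow> real \<Rightarrow> real ^ 3) \<Rightarrow> real \<Rightarrow> real \<Rightarrow> real" where
  "coeff_L X t v = partial_t (partial_t X) t v \<bullet> unit_normal X t v"

definition coeff_M :: "(real \<Rightarrow> real \<Rightarrow> real ^ 3) \<Rightarrow> real \<Rightarrow> real \<Rightarrow> real" where
  "coeff_M X t v = partial_v (partial_t X) t v \<bullet> unit_normal X t v"

definition coeff_N :: "(real \<Rightarrow> real \<Rightarrow> real ^ 3) \<Rightarrow> real \<Rightarrow> real \<Rightarrow> real" where
  "coeff_N X t v = partial_v (partial_v X) t v \<bullet> unit_normal X t v"

text \<open>
  The curvature formulas are those for surfaces of revolution, where \<open>F = M = 0\<close>.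
\<close>

definition principal_curvature_1 :: "(real \<Rightarrow> real \<Rightarrow> real ^ 3) \<Rightarrow> real \<Rightarrow> real \<Rightarrow> real" where
  "principal_curvature_1 X t v = coeff_L X t v / coeff_E X t v"

definition principal_curvature_2 :: "(real \<Rightarrow> real \<Rightarrow> real ^ 3) \<Rightarrow> real \<Rightarrow> real \<Rightarrow> real" where
  "principal_curvature_2 X t v = coeff_N X t v / coeff_G X t v"

definition mean_curvature :: "(real \<Rightarrow> real \<Rightarrow> real ^ 3) \<Rightarrow> real \<Rightarrow> real \<Rightarrow> real" where
  "mean_curvature X t v = (principal_curvature_1 X t v + principal_curvature_2 X t v) / 2"

definition gauss_curvature :: "(real \<Rightarrow> real \<Rightarrow> real ^ 3) \<Rightarrow> real \<Rightarrow> real \<Rightarrow> real" where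
  "gauss_curvature X t v =
     (coeff_L X t v * coeff_N X t v) / (coeff_E X t v * coeff_G X t v)"

text \<open>
  The curve is given by its parameters \<open>p, q\<close>, i.e. it is \<open>\<lambda>s. X (p s) (q s)\<close>; the value is the
  geodesic curvature at \<open>s\<close> when this curve has unit speed.
\<close>

definition geodesic_curvature ::
    "(real \<Rightarrow> real \<Rightarrow> real ^ 3) \<Rightarrow> (real \<Rightarrow> real) \<Rightarrow> (real \<Rightarrow> real) \<Rightarrow> real \<Rightarrow> real" where
  "geodesic_curvature X p q s =
     (let \<alpha>' = (\<lambda>r. vector_derivative (\<lambda>r. X (p r) (q r)) (at r));
          \<alpha>'' = (\<lambda>r. vector_derivative \<alpha>' (at r));
          u = (THE u. norm u = 1 \<and>
                 u \<in> span {partial_t X (p s) (q s), partial_v X (p s) (q s)} \<and>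
                 cross3 (\<alpha>' s) u = unit_normal X (p s) (q s))
      in \<alpha>'' s \<bullet> u)"

text \<open>
  \<open>\<phi>\<close> parametrizes the parallel at \<open>t\<close> by arc length, traversed with \<open>v = \<phi> s\<close> increasing.
\<close>

definition arc_length_parallel ::
    "(real \<Rightarrow> real \<Rightarrow> real ^ 3) \<Rightarrow> real \<Rightarrow> (real \<Rightarrow> real) \<Rightarrow> bool" where
  "arc_length_parallel X t \<phi> \<longleftrightarrow>
     strict_mono \<phi> \<and>
     (\<forall>s. \<phi> differentiable (at s)) \<and>
     (\<forall>s. (\<lambda>r. X t (\<phi> r)) differentiable (at s) \<and>
          norm (vector_derivative (\<lambda>r. X t (\<phi> r)) (at s)) = 1)"

definition area_density :: "(real \<Rightarrow> real \<Rightarrow> real ^ 3) \<Rightarrow> real \<Rightarrow> real \<Rightarrow> real" where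
  "area_density X t v = norm (partial_t X t v) * norm (partial_v X t v)"

definition total_curvature :: "(real \<Rightarrow> real \<Rightarrow> real ^ 3) \<Rightarrow> (real \<times> real) set \<Rightarrow> real" where
  "total_curvature X R = integral R (\<lambda>(t, v). gauss_curvature X t v * area_density X t v)"

definition hyperbola :: "real \<Rightarrow> real \<Rightarrow> (real \<times> real) set" where
  "hyperbola a b = {(x, y). x\<^sup>2 / a\<^sup>2 - y\<^sup>2 / b\<^sup>2 = 1}"

text \<open>The vertices are the points of the hyperbola on its transverse axis \<open>y = 0\<close>.\<close>

definition hyperbola_vertices :: "real \<Rightarrow> real \<Rightarrow> (real \<times> real) set" where
  "hyperbola_vertices a b = hyperbola a b \<inter> {(x, y). y = 0}"

end

(* The normal of a surface of revolution lies in the plane of the profile curve, so all curvature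
   quantities are expressions in the profile and its first two derivatives. For the nodoid the profile
   has velocity h (c sinh t, b): the tangent direction is (c sinh t, b), of length
   sqrt (c^2 cosh^2 t - a^2) because c^2 = a^2 + b^2, and the factor h drops out of f' g'' - f'' g'
   except for its square. The curvature times the area density is then c times the derivative of
   sinh t / sqrt (c^2 cosh^2 t - a^2). *)

theory Submission
  imports Defs
begin

section \<open>Vectors in three-space\<close>

lemma inner_vector_3:
  "(vector [x, y, w] :: real ^ 3) \<bullet> vector [x', y', w'] = x * x' + y * y' + w * w'"
  by (simp add: inner_vec_def sum_3)

lemma norm_vector_3: "norm (vector [x, y, w] :: real ^ 3) = sqrt (x\<^sup>2 + y\<^sup>2 + w\<^sup>2)"
  by (simp add: norm_eq_sqrt_inner inner_vector_3 power2_eq_square)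

lemma cross3_vector_3:
  "cross3 (vector [x, y, w]) (vector [x', y', w'])
    = vector [y * w' - w * y', w * x' - x * w', x * y' - y * x']"
  by (simp add: cross3_def)

lemma scaleR_vector_3: "r *\<^sub>R (vector [x, y, w] :: real ^ 3) = vector [r * x, r * y, r * w]"
  by (simp add: vec_eq_iff forall_3)

text \<open>With constant basis vectors split off, differentiating a triple reduces to the rules for
  sums and scalar multiples.\<close>

lemma vector_3_decompose:
  "(vector [x, y, w] :: real ^ 3)
    = x *\<^sub>R vector [1, 0, 0] + y *\<^sub>R vector [0, 1, 0] + w *\<^sub>R vector [0, 0, 1]"
  by (simp add: vec_eq_iff forall_3)

lemma has_vector_derivative_vector_3:
  assumes "(p has_real_derivative p') (at s)" "(q has_real_derivative q') (at s)"
    "(r has_real_derivative r') (at s)"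
  shows "((\<lambda>s. vector [p s, q s, r s] :: real ^ 3) has_vector_derivative vector [p', q', r']) (at s)"
  by (subst vector_3_decompose[of "p _"], subst vector_3_decompose[of p'])
    (rule derivative_eq_intros assms refl | simp)+

lemma norm_rotated_vector_3:
  "norm (vector [p * cos v, p * sin v, q] :: real ^ 3) = sqrt (p\<^sup>2 + q\<^sup>2)"
  by (simp add: norm_vector_3 power_mult_distrib flip: distrib_left)

text \<open>By |x x u|^2 + (x . u)^2 = |x|^2 |u|^2 the unit lengths force x and u to be orthogonal,
  and then x x (x x u) = (x . u) x - (x . x) u = -u. This gives the uniqueness behind the
  \<open>THE\<close> in \<open>geodesic_curvature\<close>.\<close>

lemma cross3_unit_solution:
  fixes x n u :: "real ^ 3"
  assumes "norm x = 1" "norm n = 1" "norm u = 1" "cross3 x u = n"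
  shows "u = cross3 n x"
proof -
  have "(x \<bullet> u)\<^sup>2 = 0"
    using norm_cross_dot[of x u] assms by simp
  then have "x \<bullet> u = 0"
    by simp
  moreover have "x \<bullet> x = 1"
    using assms(1) by (simp add: norm_eq_1)
  ultimately have "cross3 x n = - u"
    unfolding assms(4)[symmetric] by (simp add: Lagrange)
  then show ?thesis
    by (metis cross_skew minus_minus)
qed

section \<open>Surfaces of revolution\<close>

text \<open>The derivatives are parameters, so that closed forms can be supplied later.
  \<open>f_pos\<close> and \<open>regular\<close> keep the cross product of the partial derivatives
  away from zero, where \<open>unit_normal\<close> would divide by zero.\<close>

locale smooth_profile =
  fixes f g f' g' f'' g'' :: "real \<Rightarrow> real"
  assumes f_pos: "f t > 0"
    and f_deriv: "(f has_real_derivative f' t) (at t)"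
    and g_deriv: "(g has_real_derivative g' t) (at t)"
    and f'_deriv: "(f' has_real_derivative f'' t) (at t)"
    and g'_deriv: "(g' has_real_derivative g'' t) (at t)"
    and regular: "(f' t)\<^sup>2 + (g' t)\<^sup>2 > 0"
begin

abbreviation X :: "real \<Rightarrow> real \<Rightarrow> real ^ 3" where
  "X \<equiv> surface_of_revolution f g"

definition speed :: "real \<Rightarrow> real" where
  "speed t = sqrt ((f' t)\<^sup>2 + (g' t)\<^sup>2)"

lemma speed_pos: "speed t > 0"
  using regular[of t] by (simp add: speed_def)

lemma speed_square: "(speed t)\<^sup>2 = (f' t)\<^sup>2 + (g' t)\<^sup>2"
  using regular[of t] by (simp add: speed_def)

lemmas profile_derivs = f_deriv g_deriv f'_deriv g'_deriv

section \<open>First and second partial derivatives\<close>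

lemma X_deriv_t:
  "((\<lambda>s. X s v) has_vector_derivative vector [f' t * cos v, f' t * sin v, g' t]) (at t)"
  unfolding surface_of_revolution_def
  by (rule has_vector_derivative_vector_3) (rule derivative_eq_intros profile_derivs refl | simp)+

lemma X_deriv_v:
  "(X t has_vector_derivative vector [- f t * sin v, f t * cos v, 0]) (at v)"
  unfolding surface_of_revolution_def
  by (rule has_vector_derivative_vector_3) (rule derivative_eq_intros profile_derivs refl | simp)+

lemma partial_t_X: "partial_t X t v = vector [f' t * cos v, f' t * sin v, g' t]"
  unfolding partial_t_def by (rule vector_derivative_at[OF X_deriv_t])

lemma partial_v_X: "partial_v X t v = vector [- f t * sin v, f t * cos v, 0]"
  unfolding partial_v_def by (rule vector_derivative_at[OF X_deriv_v])

lemma partial_t_X_deriv_t: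
  "((\<lambda>s. partial_t X s v) has_vector_derivative vector [f'' t * cos v, f'' t * sin v, g'' t]) (at t)"
  unfolding partial_t_X
  by (rule has_vector_derivative_vector_3) (rule derivative_eq_intros profile_derivs refl | simp)+

lemma partial_t_X_deriv_v:
  "(partial_t X t has_vector_derivative vector [- f' t * sin v, f' t * cos v, 0]) (at v)"
  unfolding partial_t_X[abs_def]
  by (rule has_vector_derivative_vector_3) (rule derivative_eq_intros profile_derivs refl | simp)+

lemma partial_v_X_deriv_t:
  "((\<lambda>s. partial_v X s v) has_vector_derivative vector [- f' t * sin v, f' t * cos v, 0]) (at t)"
  unfolding partial_v_X
  by (rule has_vector_derivative_vector_3) (rule derivative_eq_intros profile_derivs refl | simp)+

lemma partial_v_X_deriv_v:
  "(partial_v X t has_vector_derivative vector [- f t * cos v, - f t * sin v, 0]) (at v)"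
  unfolding partial_v_X[abs_def]
  by (rule has_vector_derivative_vector_3) (rule derivative_eq_intros profile_derivs refl | simp)+

lemma partial_tt_X: "partial_t (partial_t X) t v = vector [f'' t * cos v, f'' t * sin v, g'' t]"
  unfolding partial_t_def[of "partial_t X"] by (rule vector_derivative_at[OF partial_t_X_deriv_t])

lemma partial_tv_X: "partial_v (partial_t X) t v = vector [- f' t * sin v, f' t * cos v, 0]"
  unfolding partial_v_def[of "partial_t X"] by (rule vector_derivative_at[OF partial_t_X_deriv_v])

lemma partial_vv_X: "partial_v (partial_v X) t v = vector [- f t * cos v, - f t * sin v, 0]"
  unfolding partial_v_def[of "partial_v X"] by (rule vector_derivative_at[OF partial_v_X_deriv_v])

lemma twice_partially_differentiable_X: "twice_partially_differentiable X"
  unfolding twice_partially_differentiable_def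
  by (intro allI conjI differentiableI_vector)
    (rule X_deriv_t X_deriv_v partial_t_X_deriv_t partial_t_X_deriv_v
      partial_v_X_deriv_t partial_v_X_deriv_v)+

section \<open>Unit normal and fundamental forms\<close>

lemma norm_partial_t_X: "norm (partial_t X t v) = speed t"
  by (simp add: partial_t_X norm_rotated_vector_3 speed_def)

lemma norm_partial_v_X: "norm (partial_v X t v) = f t"
  using f_pos[of t]
  by (simp add: partial_v_X norm_vector_3 power_mult_distrib flip: distrib_left)

lemma cross3_partials_X:
  "cross3 (partial_t X t v) (partial_v X t v)
    = f t *\<^sub>R vector [- g' t * cos v, - g' t * sin v, f' t]"
proof -
  have "f' t * cos v * (f t * cos v) + f' t * sin v * (f t * sin v)
      = f t * f' t * ((cos v)\<^sup>2 + (sin v)\<^sup>2)"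
    by algebra
  then show ?thesis
    by (simp add: partial_t_X partial_v_X cross3_vector_3 scaleR_vector_3 mult_ac)
qed

text \<open>The cross product is \<open>f t\<close> times the profile velocity turned by a quarter,
  (-g', f'), rotated to the angle \<open>v\<close>. As \<open>f t\<close> is positive it cancels
  without changing the orientation.\<close>

lemma unit_normal_X:
  "unit_normal X t v = (1 / speed t) *\<^sub>R vector [- g' t * cos v, - g' t * sin v, f' t]"
proof -
  have "norm (cross3 (partial_t X t v) (partial_v X t v)) = f t * speed t"
    unfolding cross3_partials_X using f_pos[of t]
    by (simp only: norm_scaleR norm_rotated_vector_3) (simp add: speed_def add.commute)
  then show ?thesis
    using f_pos[of t] by (simp add: unit_normal_def cross3_partials_X)
qed

lemma coeff_E_X: "coeff_E X t v = (speed t)\<^sup>2"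
  by (simp add: coeff_E_def norm_partial_t_X flip: power2_norm_eq_inner)

lemma coeff_F_X: "coeff_F X t v = 0"
  by (simp add: coeff_F_def partial_t_X partial_v_X inner_vector_3)

lemma coeff_G_X: "coeff_G X t v = (f t)\<^sup>2"
  by (simp add: coeff_G_def norm_partial_v_X flip: power2_norm_eq_inner)

text \<open>Both \<open>partial_t (partial_t X)\<close> and the normal lie in the plane of the
  profile at angle \<open>v\<close>, so \<open>v\<close> drops out; the result is the signed
  curvature of the profile times the squared speed.\<close>

lemma coeff_L_X: "coeff_L X t v = (f' t * g'' t - f'' t * g' t) / speed t"
proof -
  have "f'' t * cos v * (- g' t * cos v) + f'' t * sin v * (- g' t * sin v) + g'' t * f' t
      = f' t * g'' t - f'' t * g' t * ((cos v)\<^sup>2 + (sin v)\<^sup>2)"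
    by algebra
  then show ?thesis
    unfolding coeff_L_def partial_tt_X unit_normal_X inner_scaleR_right inner_vector_3 by simp
qed

lemma coeff_M_X: "coeff_M X t v = 0"
  by (simp add: coeff_M_def partial_tv_X unit_normal_X inner_vector_3)

lemma coeff_N_X: "coeff_N X t v = f t * g' t / speed t"
proof -
  have "- f t * cos v * (- g' t * cos v) + - f t * sin v * (- g' t * sin v) + 0 * f' t
      = f t * g' t * ((cos v)\<^sup>2 + (sin v)\<^sup>2)"
    by algebra
  then show ?thesis
    unfolding coeff_N_def partial_vv_X unit_normal_X inner_scaleR_right inner_vector_3 by simp
qed

lemma area_density_X: "area_density X t v = speed t * f t"
  by (simp add: area_density_def norm_partial_t_X norm_partial_v_X)

section \<open>Parallels and their geodesic curvature\<close>

lemma arc_length_parallel_ex: "\<exists>\<phi>. arc_length_parallel X t \<phi>"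
proof -
  have vd: "((\<lambda>r. X t (r / f t)) has_vector_derivative
      (1 / f t) *\<^sub>R partial_v X t (s / f t)) (at s)" for s
  proof -
    have "((\<lambda>s. s / f t) has_vector_derivative 1 / f t) (at s)"
      unfolding has_real_derivative_iff_has_vector_derivative[symmetric]
      using f_pos[of t] by (auto intro!: derivative_eq_intros)
    from vector_diff_chain_at[OF this X_deriv_v] show ?thesis
      by (simp only: o_def partial_v_X)
  qed
  \<comment> \<open>The parallel is a circle of radius \<open>f t\<close>, so its angle at arc
    length \<open>s\<close> is \<open>s / f t\<close>.\<close>
  have "arc_length_parallel X t (\<lambda>s. s / f t)"
    unfolding arc_length_parallel_def
  proof (intro conjI allI)
    show "strict_mono (\<lambda>s. s / f t)"
      using f_pos[of t] by (auto intro!: strict_monoI divide_strict_right_mono)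
    show "(\<lambda>s. s / f t) differentiable at s" for s
      using f_pos[of t] by (auto intro!: derivative_intros)
    show "(\<lambda>r. X t (r / f t)) differentiable at s" for s
      by (rule differentiableI_vector[OF vd])
    show "norm (vector_derivative (\<lambda>r. X t (r / f t)) (at s)) = 1" for s
      using f_pos[of t] by (simp add: vector_derivative_at[OF vd] norm_partial_v_X)
  qed
  then show ?thesis
    by blast
qed

text \<open>Unit speed fixes \<phi>' up to sign, since |\<phi>'| \<open>f t\<close> = 1, and
  monotonicity fixes the sign. Hence all arc length parametrizations share the derivatives used
  below.\<close>

lemma arc_length_parallel_deriv:
  assumes "arc_length_parallel X t \<phi>"
  shows "(\<phi> has_real_derivative 1 / f t) (at s)"
    and "((\<lambda>r. X t (\<phi> r)) has_vector_derivative vector [- sin (\<phi> s), cos (\<phi> s), 0]) (at s)"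
proof -
  from assms obtain d where d: "(\<phi> has_real_derivative d) (at s)"
    unfolding arc_length_parallel_def real_differentiable_def by blast
  have vd: "((\<lambda>r. X t (\<phi> r)) has_vector_derivative d *\<^sub>R partial_v X t (\<phi> s)) (at s)"
    using vector_diff_chain_at[of \<phi> d s "X t", OF _ X_deriv_v] d
    by (simp add: o_def partial_v_X has_real_derivative_iff_has_vector_derivative)
  have "norm (vector_derivative (\<lambda>r. X t (\<phi> r)) (at s)) = 1"
    using assms unfolding arc_length_parallel_def by blast
  then have "\<bar>d\<bar> * f t = 1"
    by (simp add: vector_derivative_at[OF vd] norm_partial_v_X)
  moreover have "mono \<phi>"
    using assms by (simp add: arc_length_parallel_def strict_mono_mono)
  then have "d \<ge> 0"
    using mono_on_imp_deriv_nonneg[of UNIV \<phi> d s] d by simp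
  ultimately have d_eq: "d = 1 / f t"
    using f_pos[of t] by (simp add: field_simps)
  show "(\<phi> has_real_derivative 1 / f t) (at s)"
    using d d_eq by simp
  show "((\<lambda>r. X t (\<phi> r)) has_vector_derivative vector [- sin (\<phi> s), cos (\<phi> s), 0]) (at s)"
    using vd f_pos[of t] unfolding d_eq partial_v_X scaleR_vector_3 by simp
qed

lemma arc_length_parallel_second_deriv:
  assumes "arc_length_parallel X t \<phi>"
  shows "((\<lambda>r. vector_derivative (\<lambda>r. X t (\<phi> r)) (at r)) has_vector_derivative
    (1 / f t) *\<^sub>R vector [- cos (\<phi> s), - sin (\<phi> s), 0]) (at s)"
  unfolding vector_derivative_at[OF arc_length_parallel_deriv(2)[OF assms]] scaleR_vector_3
  by (rule has_vector_derivative_vector_3)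
    (rule derivative_eq_intros arc_length_parallel_deriv(1)[OF assms] refl | simp)+

lemma norm_unit_normal_X: "norm (unit_normal X t v) = 1"
proof -
  have "norm (unit_normal X t v) = speed t / speed t"
    unfolding unit_normal_X norm_scaleR norm_rotated_vector_3
    using speed_pos[of t] by (simp add: speed_def add.commute)
  then show ?thesis
    using speed_pos[of t] by simp
qed

lemma geodesic_curvature_parallel:
  assumes "arc_length_parallel X t \<phi>"
  shows "geodesic_curvature X (\<lambda>_. t) \<phi> s = f' t / (f t * speed t)"
proof -
  let ?v = "\<phi> s"
  let ?T = "vector [- sin ?v, cos ?v, 0] :: real ^ 3"
  \<comment> \<open>The normal is oriented by x_t x x_v and \<open>?T\<close> points along x_v, so
    \<open>?T\<close> x u = n makes u the unit vector opposite to x_t.\<close>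
  let ?u0 = "- (1 / speed t) *\<^sub>R partial_t X t ?v"
  \<comment> \<open>The Pythagorean identity with a weight, in the shape that the cross and inner
    products produce.\<close>
  have sq: "sin ?v * (w * sin ?v) + cos ?v * (w * cos ?v) = w" for w
    using sin_cos_squared_add[of ?v] by algebra
  have cross_T: "cross3 (unit_normal X t ?v) ?T = ?u0"
    unfolding unit_normal_X partial_t_X cross_mult_left scaleR_minus_left cross3_vector_3
    using speed_pos[of t] sq[of "g' t"] by (simp add: vec_eq_iff forall_3 field_simps)
  have normal: "cross3 ?T ?u0 = unit_normal X t ?v"
    unfolding unit_normal_X partial_t_X cross_mult_right cross3_vector_3 scaleR_vector_3
    using speed_pos[of t] sq[of "f' t"] by (simp add: vec_eq_iff forall_3 field_simps)
  have normT: "norm ?T = 1"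
    by (simp add: norm_vector_3)
  have the_u: "(THE u. norm u = 1 \<and> u \<in> span {partial_t X t ?v, partial_v X t ?v} \<and>
      cross3 ?T u = unit_normal X t ?v) = ?u0"
  proof (rule the_equality, intro conjI)
    show "norm ?u0 = 1"
      using speed_pos[of t] by (simp add: norm_partial_t_X)
    show "?u0 \<in> span {partial_t X t ?v, partial_v X t ?v}"
      by (intro span_scale span_base) simp
    show "cross3 ?T ?u0 = unit_normal X t ?v"
      by (rule normal)
  next
    fix u
    assume "norm u = 1 \<and> u \<in> span {partial_t X t ?v, partial_v X t ?v} \<and>
      cross3 ?T u = unit_normal X t ?v"
    then show "u = ?u0"
      using cross3_unit_solution[OF normT norm_unit_normal_X] cross_T by metis
  qed
  have "geodesic_curvature X (\<lambda>_. t) \<phi> s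
      = ((1 / f t) *\<^sub>R vector [- cos ?v, - sin ?v, 0]) \<bullet> ?u0"
    unfolding geodesic_curvature_def Let_def
    \<comment> \<open>The second derivative contains the first as a subterm, so it is evaluated
      before the first one is.\<close>
    unfolding vector_derivative_at[OF arc_length_parallel_second_deriv[OF assms]]
    unfolding
      vector_derivative_at[OF arc_length_parallel_deriv(2)[OF assms]] the_u ..
  also have "\<dots> = f' t / (f t * speed t)"
  proof -
    have "- cos ?v * (f' t * cos ?v) + - sin ?v * (f' t * sin ?v) + 0 * g' t = - f' t"
      using sq[of "f' t"] by (simp add: algebra_simps)
    then show ?thesis
      unfolding partial_t_X inner_scaleR_left inner_scaleR_right inner_vector_3 by simp
  qed
  finally show ?thesis .
qed

end

section \<open>Integrals\<close>

lemma interval_integral_has_real_derivative: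
  fixes \<psi> :: "real \<Rightarrow> real" and t0 :: real
  assumes "continuous_on UNIV \<psi>"
  shows "((\<lambda>t. LBINT x=t0..t. \<psi> x) has_real_derivative \<psi> t) (at t)"
proof -
  \<comment> \<open>The margin 1 puts \<open>t\<close> in the interior of an interval that also
    contains \<open>t0\<close>, so the derivative within the interval is the full derivative. The
    integral is oriented, which covers \<open>t\<close> below \<open>t0\<close>.\<close>
  define l r :: real where "l = min t0 t - 1" and "r = max t0 t + 1"
  have "((\<lambda>t. LBINT x=t0..t. \<psi> x) has_vector_derivative \<psi> t) (at t within {l..r})"
    by (rule interval_integral_FTC2)
      (auto simp: l_def r_def intro: continuous_on_subset[OF assms])
  moreover have "t \<in> interior {l..r}"
    by (auto simp: l_def r_def)
  ultimately show ?thesis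
    unfolding has_real_derivative_iff_has_vector_derivative by (simp only: at_within_interior)
qed

lemma has_integral_fst_rectangle:
  fixes \<Phi> \<psi> :: "real \<Rightarrow> real"
  assumes deriv: "\<And>t. (\<Phi> has_real_derivative \<psi> t) (at t)"
    and cont: "continuous_on UNIV \<psi>" and "t1 \<le> t2" "v1 \<le> v2"
  shows "((\<lambda>(t, v). \<psi> t) has_integral (v2 - v1) * (\<Phi> t2 - \<Phi> t1)) ({t1..t2} \<times> {v1..v2})"
proof -
  have "(\<psi> has_integral \<Phi> t2 - \<Phi> t1) {t1..t2}"
    using deriv \<open>t1 \<le> t2\<close>
    by (intro fundamental_theorem_of_calculus)
      (auto simp: has_real_derivative_iff_has_vector_derivative
        intro: has_vector_derivative_at_within)
  then have int: "integral {t1..t2} \<psi> = \<Phi> t2 - \<Phi> t1"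
    by (rule integral_unique)
  have box: "{t1..t2} \<times> {v1..v2} = cbox (t1, v1) (t2, v2)"
    by (simp add: cbox_Pair_eq)
  have cont2: "continuous_on (cbox (t1, v1) (t2, v2)) (\<lambda>(t, v). \<psi> t)"
    unfolding case_prod_beta
    by (rule continuous_on_compose2[OF cont]) (auto intro: continuous_intros)
  then have "(\<lambda>(t, v). \<psi> t) integrable_on cbox (t1, v1) (t2, v2)"
    by (rule integrable_continuous)
  \<comment> \<open>Fubini: the inner integral over \<open>v\<close> is that of a constant and
    yields the factor \<open>v2 - v1\<close>.\<close>
  moreover have "integral (cbox (t1, v1) (t2, v2)) (\<lambda>(t, v). \<psi> t) = (v2 - v1) * (\<Phi> t2 - \<Phi> t1)"
    using integral_prod_continuous[OF cont2] \<open>v1 \<le> v2\<close> int by simp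
  ultimately show ?thesis
    unfolding box by (metis has_integral_integral)
qed

section \<open>The nodoid\<close>

locale nodoid =
  fixes a b c t0 :: real
    and f g h :: "real \<Rightarrow> real"
  assumes a_pos: "a > 0" and b_pos: "b > 0" and c_def: "c = sqrt (a\<^sup>2 + b\<^sup>2)"
    and f_def: "f = (\<lambda>t. b * (c * cosh t + a) / sqrt (c\<^sup>2 * (cosh t)\<^sup>2 - a\<^sup>2))"
    and g_def: "g = (\<lambda>t. (LBINT x=t0..t. sqrt (c\<^sup>2 * (cosh x)\<^sup>2 - a\<^sup>2))
               - c * sinh t * (c * cosh t + a) / sqrt (c\<^sup>2 * (cosh t)\<^sup>2 - a\<^sup>2))"
    and h_def: "h = (\<lambda>t. - (a * b) / (sqrt (c\<^sup>2 * (cosh t)\<^sup>2 - a\<^sup>2) * (c * cosh t - a)))"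
begin

section \<open>The common square root and the signs of the denominators\<close>

definition D :: "real \<Rightarrow> real" where
  "D t = sqrt (c\<^sup>2 * (cosh t)\<^sup>2 - a\<^sup>2)"

lemma c_square: "c\<^sup>2 = a\<^sup>2 + b\<^sup>2"
  by (simp add: c_def)

lemma c_gt_a: "c > a"
  using a_pos b_pos by (simp add: c_def real_less_rsqrt)

lemma c_cosh_gt_a: "c * cosh t > a"
  using c_gt_a a_pos mult_left_mono[OF cosh_real_ge_1[of t], of c] by linarith

lemma factors_pos: "c * cosh t - a > 0" "c * cosh t + a > 0"
  using c_cosh_gt_a[of t] a_pos by auto

lemma D_radicand: "c\<^sup>2 * (cosh t)\<^sup>2 - a\<^sup>2 = (c * cosh t - a) * (c * cosh t + a)"
  by (simp add: power2_eq_square algebra_simps)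

lemma D_square_pos: "c\<^sup>2 * (cosh t)\<^sup>2 - a\<^sup>2 > 0"
  unfolding D_radicand using factors_pos by simp

lemma D_pos: "D t > 0"
  using D_square_pos by (simp add: D_def)

lemma D_square: "(D t)\<^sup>2 = (c * cosh t - a) * (c * cosh t + a)"
  unfolding D_def D_radicand[symmetric] using D_square_pos[of t] by simp

text \<open>Combines cosh^2 = 1 + sinh^2 with c^2 - a^2 = b^2. The factored form
  \<open>D_square\<close> serves to cancel fractions; this form serves for the speed and for the
  primitive of the curvature.\<close>

lemma D_square_sinh: "(D t)\<^sup>2 = c\<^sup>2 * (sinh t)\<^sup>2 + b\<^sup>2"
  using D_square_pos[of t] by (simp add: D_def c_square cosh_square_eq algebra_simps)

lemma D_deriv: "(D has_real_derivative c\<^sup>2 * cosh t * sinh t / D t) (at t)"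
proof -
  have "((\<lambda>t. c\<^sup>2 * (cosh t)\<^sup>2 - a\<^sup>2) has_real_derivative 2 * c\<^sup>2 * cosh t * sinh t) (at t)"
    by (rule derivative_eq_intros refl | simp)+
  from DERIV_chain2[OF DERIV_real_sqrt[OF D_square_pos] this] show ?thesis
    by (simp add: D_def[abs_def] field_simps)
qed

lemma D_continuous: "continuous_on UNIV D"
  by (meson D_deriv DERIV_isCont continuous_at_imp_continuous_on)

lemma f_eq: "f t = b * (c * cosh t + a) / D t"
  by (simp add: f_def D_def)

lemma h_eq: "h t = - (a * b) / (D t * (c * cosh t - a))"
  by (simp add: h_def D_def)

lemma h_neg: "h t < 0"
  unfolding h_eq using D_pos factors_pos a_pos b_pos by (simp add: divide_neg_pos)

lemma f_pos: "f t > 0"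
  unfolding f_eq using D_pos factors_pos b_pos by simp

section \<open>Velocity of the profile\<close>

lemma f_deriv: "(f has_real_derivative c * sinh t * h t) (at t)"
proof -
  have "(f has_real_derivative
      (b * (c * sinh t) * D t - b * (c * cosh t + a) * (c\<^sup>2 * cosh t * sinh t / D t))
        / (D t * D t)) (at t)"
    unfolding f_eq[abs_def]
    by (rule derivative_eq_intros D_deriv refl | use D_pos[of t] in simp)+
  moreover have "(b * (c * sinh t) * D t - b * (c * cosh t + a) * (c\<^sup>2 * cosh t * sinh t / D t))
        / (D t * D t) = c * sinh t * h t"
  proof -
    \<comment> \<open>The claim multiplied by (D t)^3 (c cosh t - a): only even powers of
      \<open>D t\<close> are left, so \<open>D_square\<close> makes it a polynomial
      identity.\<close>
    have "(b * (c * sinh t) * (D t)\<^sup>2 - b * (c * cosh t + a) * (c\<^sup>2 * cosh t * sinh t))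
        * (c * cosh t - a) = - (c * sinh t * a * b * (D t)\<^sup>2)"
      unfolding D_square by algebra
    then show ?thesis
      unfolding h_eq using D_pos[of t] factors_pos[of t]
      by (simp add: divide_simps power2_eq_square) (simp add: algebra_simps)
  qed
  ultimately show ?thesis
    by simp
qed

lemma g_deriv: "(g has_real_derivative b * h t) (at t)"
proof -
  have g_eq: "g = (\<lambda>t. (LBINT x=t0..t. D x) - c * sinh t * (c * cosh t + a) / D t)"
    by (simp add: g_def D_def)
  have "(g has_real_derivative
      D t - ((c * cosh t * (c * cosh t + a) + c * sinh t * (c * sinh t)) * D t
        - c * sinh t * (c * cosh t + a) * (c\<^sup>2 * cosh t * sinh t / D t)) / (D t * D t)) (at t)"
    unfolding g_eq
    by (rule derivative_eq_intros interval_integral_has_real_derivative[OF D_continuous] D_deriv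
        refl | use D_pos[of t] in simp)+
  moreover have "D t - ((c * cosh t * (c * cosh t + a) + c * sinh t * (c * sinh t)) * D t
        - c * sinh t * (c * cosh t + a) * (c\<^sup>2 * cosh t * sinh t / D t)) / (D t * D t) = b * h t"
  proof -
    \<comment> \<open>Cleared of denominators by the same factor as for \<open>f\<close>; here the
      identity also rests on cosh^2 = 1 + sinh^2 and c^2 = a^2 + b^2.\<close>
    have "((D t)\<^sup>2 * (D t)\<^sup>2 - ((c * cosh t * (c * cosh t + a) + c * sinh t * (c * sinh t)) * (D t)\<^sup>2
        - c * sinh t * (c * cosh t + a) * (c\<^sup>2 * cosh t * sinh t))) * (c * cosh t - a)
        = - (a * b\<^sup>2 * (D t)\<^sup>2)"
      using cosh_square_eq[of t] c_square unfolding D_square by algebra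
    then show ?thesis
      unfolding h_eq using D_pos[of t] factors_pos[of t]
      by (simp add: divide_simps power2_eq_square) (simp add: algebra_simps)
  qed
  ultimately show ?thesis
    by simp
qed

text \<open>Differentiability suffices: \<open>deriv h t\<close> cancels from f' g'' - f'' g', the
  only way in which second derivatives of the profile enter the curvatures.\<close>

lemma h_deriv: "(h has_real_derivative deriv h t) (at t)"
proof -
  have "\<exists>d. (h has_real_derivative d) (at t)"
    unfolding h_eq[abs_def]
    by (rule exI) (rule derivative_eq_intros D_deriv refl | use D_pos[of t] factors_pos[of t] in simp)+
  then show ?thesis
    by (metis DERIV_imp_deriv)
qed

text \<open>The squared length of (c sinh t, b) is \<open>(D t)\<^sup>2\<close>. The minus sign
  selects the positive root, because \<open>h\<close> is negative.\<close>

lemma speed_eq: "(c * sinh t * h t)\<^sup>2 + (b * h t)\<^sup>2 = (- (h t) * D t)\<^sup>2"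
proof -
  have "(- (h t) * D t)\<^sup>2 = (h t)\<^sup>2 * (D t)\<^sup>2"
    by (simp add: power_mult_distrib)
  then show ?thesis
    unfolding D_square_sinh by algebra
qed

sublocale smooth_profile f g "\<lambda>t. c * sinh t * h t" "\<lambda>t. b * h t"
  "\<lambda>t. c * cosh t * h t + c * sinh t * deriv h t" "\<lambda>t. b * deriv h t"
proof
  fix t
  show "0 < (c * sinh t * h t)\<^sup>2 + (b * h t)\<^sup>2"
    unfolding speed_eq using h_neg[of t] D_pos[of t] by simp
  show "((\<lambda>t. c * sinh t * h t) has_real_derivative
      c * cosh t * h t + c * sinh t * deriv h t) (at t)"
    by (rule derivative_eq_intros h_deriv refl | simp)+
  show "((\<lambda>t. b * h t) has_real_derivative b * deriv h t) (at t)"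
    by (rule derivative_eq_intros h_deriv refl | simp)+
qed (rule f_pos f_deriv g_deriv)+

lemma speed_nodoid: "speed t = - (h t) * D t"
  unfolding speed_def speed_eq using h_neg[of t] D_pos[of t] by (simp add: abs_mult)

lemma speed_nodoid_explicit: "speed t = a * b / (c * cosh t - a)"
  unfolding speed_nodoid unfolding h_eq using D_pos[of t] by simp

section \<open>Normal, fundamental forms and curvatures of the nodoid\<close>

lemma unit_normal_nodoid:
  "unit_normal X t v = (1 / D t) *\<^sub>R vector [b * cos v, b * sin v, - c * sinh t]"
  \<comment> \<open>Dividing (-b h, c sinh t h) by -h D gives (b, -c sinh t) / D. The negative sign
    of \<open>h\<close> thus makes the normal point away from the axis, whence the negative
    \<open>L\<close> and \<open>N\<close>.\<close>
  unfolding unit_normal_X speed_nodoid scaleR_vector_3 using h_neg[of t] by simp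

lemma coeff_E_nodoid: "coeff_E X t v = a\<^sup>2 * b\<^sup>2 / (c * cosh t - a)\<^sup>2"
  unfolding coeff_E_X speed_nodoid_explicit by (simp add: power_divide power_mult_distrib)

lemma coeff_G_nodoid: "coeff_G X t v = b\<^sup>2 * (c * cosh t + a) / (c * cosh t - a)"
  unfolding coeff_G_X unfolding f_eq power_divide D_square using factors_pos[of t]
  by (simp add: power2_eq_square)

lemma coeff_L_nodoid:
  "coeff_L X t v = - (a * b\<^sup>2 * c * cosh t) / ((D t)\<^sup>2 * (c * cosh t - a))"
proof -
  \<comment> \<open>The terms with \<open>deriv h t\<close> cancel, leaving -b c cosh t h^2 divided
    by -h D.\<close>
  have "coeff_L X t v = b * c * cosh t * h t / D t"
    unfolding coeff_L_X speed_nodoid using h_neg[of t] D_pos[of t]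
    by (simp add: field_simps)
  then show ?thesis
    unfolding h_eq by (simp add: power2_eq_square mult_ac)
qed

lemma coeff_N_nodoid: "coeff_N X t v = - (b\<^sup>2) / (c * cosh t - a)"
proof -
  have "coeff_N X t v = - b * f t / D t"
    unfolding coeff_N_X speed_nodoid using h_neg[of t] D_pos[of t] by (simp add: field_simps)
  also have "\<dots> = - (b\<^sup>2 * (c * cosh t + a)) / (D t)\<^sup>2"
    unfolding f_eq by (simp add: power2_eq_square)
  finally show ?thesis
    unfolding D_square using factors_pos[of t] by simp
qed

lemma principal_curvature_1_nodoid:
  "principal_curvature_1 X t v = - (c * cosh t) / (a * (c * cosh t + a))"
  unfolding principal_curvature_1_def coeff_L_nodoid coeff_E_nodoid D_square
  using factors_pos[of t] a_pos b_pos by (simp add: power2_eq_square)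

lemma principal_curvature_2_nodoid: "principal_curvature_2 X t v = - 1 / (c * cosh t + a)"
  unfolding principal_curvature_2_def coeff_N_nodoid coeff_G_nodoid
  using factors_pos[of t] b_pos by simp

lemma mean_curvature_nodoid: "mean_curvature X t v = - 1 / (2 * a)"
proof -
  \<comment> \<open>Over the denominator a (c cosh t + a) the numerator is -(c cosh t + a), so
    \<open>t\<close> drops out.\<close>
  have "- (c * cosh t) / (a * (c * cosh t + a)) + - 1 / (c * cosh t + a)
      = - 1 / a"
    using factors_pos[of t] a_pos by (simp add: divide_simps)
  then show ?thesis
    by (simp add: mean_curvature_def principal_curvature_1_nodoid principal_curvature_2_nodoid)
qed

lemma gauss_curvature_nodoid:
  "gauss_curvature X t v = c * cosh t / (a * (c * cosh t + a)\<^sup>2)"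
proof -
  have "gauss_curvature X t v = principal_curvature_1 X t v * principal_curvature_2 X t v"
    by (simp add: gauss_curvature_def principal_curvature_1_def principal_curvature_2_def)
  then show ?thesis
    by (simp add: principal_curvature_1_nodoid principal_curvature_2_nodoid power2_eq_square)
qed

text \<open>In f' / (f speed) the factor \<open>h\<close> cancels up to the sign -1, and
  \<open>f t * D t\<close> is b (c cosh t + a).\<close>

lemma geodesic_curvature_nodoid:
  assumes "arc_length_parallel X t \<phi>"
  shows "geodesic_curvature X (\<lambda>_. t) \<phi> s = - (c * sinh t) / (b * (c * cosh t + a))"
  unfolding geodesic_curvature_parallel[OF assms] speed_nodoid unfolding f_eq
  using h_neg[of t] D_pos[of t] by simp

section \<open>Total curvature\<close>

lemma curvature_area_density:
  "gauss_curvature X t v * area_density X t v = b\<^sup>2 * c * cosh t / (D t)^3"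
proof -
  have "(D t)^3 = (c * cosh t - a) * (c * cosh t + a) * D t"
    by (simp add: power3_eq_cube D_square[symmetric] power2_eq_square)
  then show ?thesis
    unfolding gauss_curvature_nodoid area_density_X speed_nodoid_explicit unfolding f_eq
    using factors_pos[of t] a_pos by (simp add: power2_eq_square mult_ac)
qed

lemma curvature_primitive:
  "((\<lambda>t. c * (sinh t / D t)) has_real_derivative b\<^sup>2 * c * cosh t / (D t)^3) (at t)"
proof -
  have "((\<lambda>t. c * (sinh t / D t)) has_real_derivative
      c * ((cosh t * D t - sinh t * (c\<^sup>2 * cosh t * sinh t / D t)) / (D t * D t))) (at t)"
    by (rule derivative_eq_intros D_deriv refl | use D_pos[of t] in simp)+
  \<comment> \<open>Brings out D^2 - c^2 sinh^2, which is the constant b^2 by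
    \<open>D_square_sinh\<close>.\<close>
  moreover have "c * ((cosh t * D t - sinh t * (c\<^sup>2 * cosh t * sinh t / D t)) / (D t * D t))
      = c * cosh t * ((D t)\<^sup>2 - c\<^sup>2 * (sinh t)\<^sup>2) / (D t)^3"
    using D_pos[of t] by (simp add: field_simps power2_eq_square power3_eq_cube)
  ultimately show ?thesis
    by (simp add: D_square_sinh mult_ac)
qed

text \<open>Stated with \<open>has_integral\<close> because \<open>integral\<close> alone would be 0
  for a non-integrable function; this form yields integrability and value together.\<close>

lemma total_curvature_has_integral:
  assumes "t1 < t2" "v1 < v2"
  shows "((\<lambda>(t, v). gauss_curvature X t v * area_density X t v) has_integral
      c * (v2 - v1) * (sinh t2 / D t2 - sinh t1 / D t1)) ({t1..t2} \<times> {v1..v2})"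
proof -
  have "continuous_on UNIV (\<lambda>t. b\<^sup>2 * c * cosh t / (D t)^3)"
    using D_pos by (intro continuous_intros D_continuous) (simp add: less_imp_neq[symmetric])
  then have "((\<lambda>(t, v). b\<^sup>2 * c * cosh t / (D t)^3) has_integral
      (v2 - v1) * (c * (sinh t2 / D t2) - c * (sinh t1 / D t1))) ({t1..t2} \<times> {v1..v2})"
    using assms by (intro has_integral_fst_rectangle curvature_primitive) auto
  moreover have "(v2 - v1) * (c * (sinh t2 / D t2) - c * (sinh t1 / D t1))
      = c * (v2 - v1) * (sinh t2 / D t2 - sinh t1 / D t1)"
    by algebra
  ultimately show ?thesis
    unfolding curvature_area_density by metis
qed

end

lemma hyperbola_vertices_eq:
  assumes "a > 0"
  shows "hyperbola_vertices a b = {(a, 0), (- a, 0)}"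
  using assms by (auto simp: hyperbola_vertices_def hyperbola_def power2_eq_iff)

theorem mainTheorem7:
  fixes a b c t0 :: real
    and f g h :: "real \<Rightarrow> real"
    and z :: "real \<Rightarrow> real \<Rightarrow> real ^ 3"
  assumes "a > 0" and "b > 0" and "c = sqrt (a\<^sup>2 + b\<^sup>2)"
    and "f = (\<lambda>t. b * (c * cosh t + a) / sqrt (c\<^sup>2 * (cosh t)\<^sup>2 - a\<^sup>2))"
    and "g = (\<lambda>t. (LBINT x=t0..t. sqrt (c\<^sup>2 * (cosh x)\<^sup>2 - a\<^sup>2))
               - c * sinh t * (c * cosh t + a) / sqrt (c\<^sup>2 * (cosh t)\<^sup>2 - a\<^sup>2))"
    and "h = (\<lambda>t. - (a * b) / (sqrt (c\<^sup>2 * (cosh t)\<^sup>2 - a\<^sup>2) * (c * cosh t - a)))"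
    and "z = surface_of_revolution f g"
  shows
    "(\<forall>t. f t > 0) \<and>
     twice_partially_differentiable z \<and>
     (\<forall>t v. partial_t z t v
        = vector [c * sinh t * h t * cos v, c * sinh t * h t * sin v, b * h t]) \<and>
     (\<forall>t v. partial_v z t v = vector [- f t * sin v, f t * cos v, 0]) \<and>
     (\<forall>t v. unit_normal z t v
        = (1 / sqrt (c\<^sup>2 * (cosh t)\<^sup>2 - a\<^sup>2)) *\<^sub>R vector [b * cos v, b * sin v, - c * sinh t]) \<and>
     (\<forall>t v. coeff_E z t v = a\<^sup>2 * b\<^sup>2 / (c * cosh t - a)\<^sup>2 \<and> coeff_E z t v \<noteq> 0) \<and>
     (\<forall>t v. coeff_F z t v = 0) \<and>
     (\<forall>t v. coeff_G z t v = b\<^sup>2 * (c * cosh t + a) / (c * cosh t - a) \<and> coeff_G z t v \<noteq> 0) \<and>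
     (\<forall>t v. coeff_L z t v
        = - (a * b\<^sup>2 * c * cosh t) / ((c\<^sup>2 * (cosh t)\<^sup>2 - a\<^sup>2) * (c * cosh t - a)) \<and>
        coeff_L z t v \<noteq> 0) \<and>
     (\<forall>t v. coeff_M z t v = 0) \<and>
     (\<forall>t v. coeff_N z t v = - (b\<^sup>2) / (c * cosh t - a) \<and> coeff_N z t v \<noteq> 0) \<and>
     (\<forall>t v. principal_curvature_1 z t v = - (c * cosh t) / (a * (c * cosh t + a))) \<and>
     (\<forall>t v. principal_curvature_2 z t v = - 1 / (c * cosh t + a)) \<and>
     (\<forall>t v. mean_curvature z t v = - 1 / (2 * a)) \<and>
     (\<forall>t v. gauss_curvature z t v = c * cosh t / (a * (c * cosh t + a)\<^sup>2)) \<and>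
     (\<exists>P Q. hyperbola_vertices a b = {P, Q} \<and> dist P Q = 2 * a \<and>
        (\<forall>t v. mean_curvature z t v = - inverse (dist P Q))) \<and>
     (\<forall>t. (\<exists>\<phi>. arc_length_parallel z t \<phi>) \<and>
        (\<forall>\<phi>. arc_length_parallel z t \<phi> \<longrightarrow>
           (\<forall>s. (\<lambda>r. vector_derivative (\<lambda>r. z t (\<phi> r)) (at r)) differentiable (at s) \<and>
                geodesic_curvature z (\<lambda>_. t) \<phi> s = - (c * sinh t) / (b * (c * cosh t + a))))) \<and>
     (\<forall>t1 t2 v1 v2. t1 < t2 \<longrightarrow> v1 < v2 \<longrightarrow>
        (\<lambda>(t, v). gauss_curvature z t v * area_density z t v) integrable_on
          ({t1..t2} \<times> {v1..v2}) \<and>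
        total_curvature z ({t1..t2} \<times> {v1..v2})
          = c * (v2 - v1) * (sinh t2 / sqrt (c\<^sup>2 * (cosh t2)\<^sup>2 - a\<^sup>2)
                             - sinh t1 / sqrt (c\<^sup>2 * (cosh t1)\<^sup>2 - a\<^sup>2)))"
proof -
  interpret nodoid a b c t0 f g h
    using assms by unfold_locales auto
  have D_radicand_eq: "c\<^sup>2 * (cosh t)\<^sup>2 - a\<^sup>2 = (D t)\<^sup>2" for t
    by (simp add: D_square D_radicand)
  have c_cosh: "c * cosh t > 0" for t
    using c_cosh_gt_a[of t] a_pos by linarith
  have nonzero: "coeff_E z t v \<noteq> 0" "coeff_G z t v \<noteq> 0" "coeff_L z t v \<noteq> 0" "coeff_N z t v \<noteq> 0"
    for t v
    using factors_pos[of t] a_pos b_pos D_pos[of t] c_cosh[of t]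
    by (auto simp: assms(7) coeff_E_nodoid coeff_G_nodoid coeff_L_nodoid coeff_N_nodoid)
  have vertices: "\<exists>P Q. hyperbola_vertices a b = {P, Q} \<and> dist P Q = 2 * a \<and>
      (\<forall>t v. mean_curvature z t v = - inverse (dist P Q))"
  proof (intro exI conjI allI)
    show "hyperbola_vertices a b = {(a, 0), (- a, 0)}"
      by (rule hyperbola_vertices_eq[OF a_pos])
    show dist: "dist (a, 0 :: real) (- a, 0) = 2 * a"
      using a_pos by (simp add: dist_Pair_Pair dist_real_def real_sqrt_mult)
    show "mean_curvature z t v = - inverse (dist (a, 0 :: real) (- a, 0))" for t v
      unfolding dist by (simp add: assms(7) mean_curvature_nodoid inverse_eq_divide)
  qed
  show ?thesis
    \<comment> \<open>First the square roots become \<open>D\<close>; the bare radicand that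
      remains, in the formula for \<open>L\<close>, then becomes
      \<open>(D t)\<^sup>2\<close>.\<close>
    unfolding D_def[symmetric] unfolding D_radicand_eq
  proof (intro conjI allI impI)
    fix t \<phi> s
    assume "arc_length_parallel z t \<phi>"
    then have \<phi>: "arc_length_parallel X t \<phi>"
      by (simp add: assms(7))
    show "(\<lambda>r. vector_derivative (\<lambda>r. z t (\<phi> r)) (at r)) differentiable (at s)"
      unfolding assms(7) by (rule differentiableI_vector[OF arc_length_parallel_second_deriv[OF \<phi>]])
    show "geodesic_curvature z (\<lambda>_. t) \<phi> s = - (c * sinh t) / (b * (c * cosh t + a))"
      unfolding assms(7) by (rule geodesic_curvature_nodoid[OF \<phi>])
  next
    fix t1 t2 v1 v2 :: real
    assume "t1 < t2" "v1 < v2"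
    note int = total_curvature_has_integral[OF this]
    show "(\<lambda>(t, v). gauss_curvature z t v * area_density z t v) integrable_on
        ({t1..t2} \<times> {v1..v2})"
      unfolding assms(7) using int by blast
    show "total_curvature z ({t1..t2} \<times> {v1..v2})
        = c * (v2 - v1) * (sinh t2 / D t2 - sinh t1 / D t1)"
      unfolding assms(7) total_curvature_def by (rule integral_unique[OF int])
  qed (unfold assms(7), (rule nonzero[unfolded assms(7)] vertices[unfolded assms(7)] f_pos
      twice_partially_differentiable_X partial_t_X partial_v_X unit_normal_nodoid
      coeff_E_nodoid coeff_F_X coeff_G_nodoid coeff_L_nodoid coeff_M_X coeff_N_nodoid
      principal_curvature_1_nodoid principal_curvature_2_nodoid mean_curvature_nodoid
      gauss_curvature_nodoid arc_length_parallel_ex)+)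
qed

end
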